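(* For integers $n,x\ge0$ and finite sets $N,X$ with $|N|=n$, $|X|=x$, let $\alpha(n,x)$ be the number of $S_N\times S_X$-orbits of all homomorphisms $\mathcal P(N)\to\mathcal P(X)$ (equivalently, of all $n$-families of subsets of $X$), let $\beta(n,x)$ be the number of $S_N\times S_X$-orbits of meet-unitary homomorphisms (equivalently, of $n$-coverings of $X$), and let $\gamma(n,x)$ be the number of $S_N\times S_X$-orbits of hypergraphs (equivalently, of relations between $N$ and $X$ that are both left and right surjective). Then $$\beta(n,x)=\alpha(n,x)-\alpha(n,x-1),\qquad \gamma(n,x)=\beta(n,x)-\beta(n-1,x),$$ where terms with a negative argument are taken to be $0$.
   Context: An $n$-family of subsets of $X$ is a tuple $F=(F_i)_{i\in N}$ with $F_i\subseteq X$; it is a covering if $\bigcup_{i\in N}F_i=X$, and a hypergraph if it is a covering with $F_i\neq\varnothing$ for every $i$. A homomorphism is a map $\phi\colon\mathcal P(N)\to\mathcal P(X)$ with $\phi(I\cup J)=\phi(I)\cup\phi(J)$ for all $I,J\subseteq N$ and $\phi(\varnothing)=\varnothing$; it corresponds bijectively to the family $F_i=\phi(\{i\})$, with $\phi(I)=\bigcup_{i\in I}F_i$, and to the relation $R=\{(i,a):a\in F_i\}\subseteq N\times X$. It is meet-unitary if $\phi(N)=X$. A relation $R$ is right surjective if for every $a\in X$ there is some $i$ with $(i,a)\in R$, left surjective if for every $i\in N$ there is some $a$ with $(i,a)\in R$. The group $S_N\times S_X$ acts on families by $(\pi,\sigma)\cdot(F_i)_{i\in N}=(\sigma(F_{\pi^{-1}(i)}))_{i\in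 N}$, on homomorphisms by $((\pi,\sigma)\cdot\phi)(I)=\sigma(\phi(\pi^{-1}(I)))$, and on relations by $(\pi,\sigma)\cdot R=\{(\pi(i),\sigma(a)):(i,a)\in R\}$. *)

theory Defs
  imports "HOL-Algebra.Group_Action" "HOL-Library.FuncSet"
begin

text \<open>Functions with a set as domain are extensional, so that they are determined by
  their values on that set and can be counted.\<close>

definition families :: "'a set \<Rightarrow> 'b set \<Rightarrow> ('a \<Rightarrow> 'b set) set" where
  "families N X = N \<rightarrow>\<^sub>E Pow X"

definition coverings :: "'a set \<Rightarrow> 'b set \<Rightarrow> ('a \<Rightarrow> 'b set) set" where
  "coverings N X = {F \<in> families N X. (\<Union>i\<in>N. F i) = X}"

definition hypergraphs :: "'a set \<Rightarrow> 'b set \<Rightarrow> ('a \<Rightarrow> 'b set) set" where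
  "hypergraphs N X = {F \<in> coverings N X. \<forall>i\<in>N. F i \<noteq> {}}"

definition homomorphisms :: "'a set \<Rightarrow> 'b set \<Rightarrow> ('a set \<Rightarrow> 'b set) set" where
  "homomorphisms N X =
    {\<phi> \<in> Pow N \<rightarrow>\<^sub>E Pow X. (\<forall>I\<in>Pow N. \<forall>J\<in>Pow N. \<phi> (I \<union> J) = \<phi> I \<union> \<phi> J) \<and> \<phi> {} = {}}"

definition meet_unitary_homomorphisms :: "'a set \<Rightarrow> 'b set \<Rightarrow> ('a set \<Rightarrow> 'b set) set" where
  "meet_unitary_homomorphisms N X = {\<phi> \<in> homomorphisms N X. \<phi> N = X}"

definition left_surjective :: "'a set \<Rightarrow> ('a \<times> 'b) set \<Rightarrow> bool" where
  "left_surjective N R \<longleftrightarrow> (\<forall>i\<in>N. \<exists>a. (i, a) \<in> R)"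

definition right_surjective :: "'b set \<Rightarrow> ('a \<times> 'b) set \<Rightarrow> bool" where
  "right_surjective X R \<longleftrightarrow> (\<forall>a\<in>X. \<exists>i. (i, a) \<in> R)"

definition bisurjective_relations :: "'a set \<Rightarrow> 'b set \<Rightarrow> ('a \<times> 'b) set set" where
  "bisurjective_relations N X = {R \<in> Pow (N \<times> X). left_surjective N R \<and> right_surjective X R}"


abbreviation sym_prod :: "'a set \<Rightarrow> 'b set \<Rightarrow> (('a \<Rightarrow> 'a) \<times> ('b \<Rightarrow> 'b)) monoid" where
  "sym_prod N X \<equiv> BijGroup N \<times>\<times> BijGroup X"

text \<open>The actions below are not restricted to the set acted upon;
  \<^const>\<open>orbits\<close> only evaluates them at elements of that set.\<close>

definition family_action ::
    "'a set \<Rightarrow> ('a \<Rightarrow> 'a) \<times> ('b \<Rightarrow> 'b) \<Rightarrow> ('a \<Rightarrow> 'b set) \<Rightarrow> ('a \<Rightarrow> 'b set)" where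
  "family_action N = (\<lambda>(\<pi>, \<sigma>) F. \<lambda>i\<in>N. \<sigma> ` F (inv_into N \<pi> i))"

definition homomorphism_action ::
    "'a set \<Rightarrow> ('a \<Rightarrow> 'a) \<times> ('b \<Rightarrow> 'b) \<Rightarrow> ('a set \<Rightarrow> 'b set) \<Rightarrow> ('a set \<Rightarrow> 'b set)" where
  "homomorphism_action N = (\<lambda>(\<pi>, \<sigma>) \<phi>. \<lambda>I\<in>Pow N. \<sigma> ` \<phi> (inv_into N \<pi> ` I))"

definition relation_action ::
    "('a \<Rightarrow> 'a) \<times> ('b \<Rightarrow> 'b) \<Rightarrow> ('a \<times> 'b) set \<Rightarrow> ('a \<times> 'b) set" where
  "relation_action = (\<lambda>(\<pi>, \<sigma>) R. {(\<pi> i, \<sigma> a) | i a. (i, a) \<in> R})"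


abbreviation family_orbits ::
    "'a set \<Rightarrow> 'b set \<Rightarrow> ('a \<Rightarrow> 'b set) set \<Rightarrow> ('a \<Rightarrow> 'b set) set set" where
  "family_orbits N X E \<equiv> orbits (sym_prod N X) E (family_action N)"

abbreviation homomorphism_orbits ::
    "'a set \<Rightarrow> 'b set \<Rightarrow> ('a set \<Rightarrow> 'b set) set \<Rightarrow> ('a set \<Rightarrow> 'b set) set set" where
  "homomorphism_orbits N X E \<equiv> orbits (sym_prod N X) E (homomorphism_action N)"

abbreviation relation_orbits ::
    "'a set \<Rightarrow> 'b set \<Rightarrow> ('a \<times> 'b) set set \<Rightarrow> ('a \<times> 'b) set set set" where
  "relation_orbits N X E \<equiv> orbits (sym_prod N X) E relation_action"


text \<open>The counting functions use the representatives \<open>{..<n}\<close> and \<open>{..<x}\<close> of the finite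
  sets with \<open>n\<close> and \<open>x\<close> elements. The arguments are integers and the value at a negative
  argument is 0 by convention.\<close>

definition alpha :: "int \<Rightarrow> int \<Rightarrow> int" where
  "alpha n x = (if n < 0 \<or> x < 0 then 0 else
    (let N = {..<nat n}; X = {..<nat x} in
      int (card (homomorphism_orbits N X (homomorphisms N X)))))"

definition beta :: "int \<Rightarrow> int \<Rightarrow> int" where
  "beta n x = (if n < 0 \<or> x < 0 then 0 else
    (let N = {..<nat n}; X = {..<nat x} in
      int (card (homomorphism_orbits N X (meet_unitary_homomorphisms N X)))))"

definition gamma :: "int \<Rightarrow> int \<Rightarrow> int" where
  "gamma n x = (if n < 0 \<or> x < 0 then 0 else
    (let N = {..<nat n}; X = {..<nat x} in
      int (card (family_orbits N X (hypergraphs N X)))))"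

end

theory Submission
  imports Defs
begin

text \<open>
  Isolated points are invisible to an orbit. Encode a family, or a homomorphism, as its
  relation \<open>R \<subseteq> N \<times> X\<close>. An injection of the domain of \<open>R\<close> into the finite set \<open>N\<close> extends
  to a permutation of \<open>N\<close>, and likewise for the range of \<open>R\<close> and \<open>X\<close>. Two relations in
  \<open>N \<times> X\<close> therefore lie in the same orbit iff they are isomorphic by maps that are defined
  only on their domains and ranges (\<open>relation_orbit_eq\<close>), and this condition does not
  mention \<open>N\<close> and \<open>X\<close>. So an orbit in \<open>N \<times> X\<close> is the same thing as an isomorphism type of
  finite relations that is small enough to fit (\<open>card_relation_orbits\<close>).

  Each type has a well-defined pair (size of the domain, size of the range). Right
  surjectivity says that the range has full size, left surjectivity that the domain has.
  Hence \<open>alpha n x\<close> counts the types whose pair lies in \<open>{..n} \<times> {..x}\<close>, \<open>beta n x\<close> those with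
  pair in \<open>{..n} \<times> {x}\<close>, and \<open>gamma n x\<close> those with pair \<open>(n, x)\<close>. Both recurrences express
  that removing the last row or the last column of a rectangle leaves the smaller
  rectangle.
\<close>

section \<open>Isomorphism of relations\<close>

text \<open>The two relations may live over different types, which is what allows orbits over
  different base sets to be compared. The maps matter only on the domain and the range, so
  elements related to nothing are ignored.\<close>

definition rel_iso :: "('a \<times> 'b) set \<Rightarrow> ('c \<times> 'd) set \<Rightarrow> bool" where
  "rel_iso R S \<longleftrightarrow>
    (\<exists>f g. inj_on f (Domain R) \<and> inj_on g (Range R) \<and> S = map_prod f g ` R)"

lemma Domain_map_prod_image: "Domain (map_prod f g ` R) = f ` Domain R"
  by (force simp: Domain_iff image_iff)

lemma Range_map_prod_image: "Range (map_prod f g ` R) = g ` Range R"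
  by (force simp: Range_iff image_iff)

lemma rel_iso_refl: "rel_iso R R"
  unfolding rel_iso_def by (intro exI[of _ id]) (simp add: map_prod.id)

lemma rel_iso_sym:
  assumes "rel_iso R S"
  shows "rel_iso S R"
proof -
  from assms obtain f g where f: "inj_on f (Domain R)" and g: "inj_on g (Range R)"
    and S: "S = map_prod f g ` R"
    by (auto simp: rel_iso_def)
  let ?f = "inv_into (Domain R) f" and ?g = "inv_into (Range R) g"
  have "map_prod ?f ?g (map_prod f g p) = p" if "p \<in> R" for p
    using that f g by (cases p) (auto simp: inv_into_f_f Domain.DomainI Range.RangeI)
  then have "R = map_prod ?f ?g ` S"
    unfolding S image_image by simp
  moreover have "inj_on ?f (Domain S)" "inj_on ?g (Range S)"
    unfolding S Domain_map_prod_image Range_map_prod_image by (simp_all add: inj_on_inv_into)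
  ultimately show ?thesis
    unfolding rel_iso_def by blast
qed

lemma rel_iso_trans:
  assumes "rel_iso R S" "rel_iso S T"
  shows "rel_iso R T"
proof -
  from assms(1) obtain f g where f: "inj_on f (Domain R)" and g: "inj_on g (Range R)"
    and S: "S = map_prod f g ` R"
    by (auto simp: rel_iso_def)
  from assms(2) obtain f' g' where f': "inj_on f' (Domain S)" and g': "inj_on g' (Range S)"
    and T: "T = map_prod f' g' ` S"
    by (auto simp: rel_iso_def)
  have "inj_on (f' \<circ> f) (Domain R)" "inj_on (g' \<circ> g) (Range R)"
    using f f' g g' unfolding S Domain_map_prod_image Range_map_prod_image
    by (simp_all add: comp_inj_on)
  moreover have "T = map_prod (f' \<circ> f) (g' \<circ> g) ` R"
    unfolding T S image_image by (simp add: map_prod_def case_prod_unfold)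
  ultimately show ?thesis
    unfolding rel_iso_def by blast
qed

lemma rel_iso_card:
  assumes "rel_iso R S"
  shows "card (Domain S) = card (Domain R)" "card (Range S) = card (Range R)"
  using assms
  by (auto simp: rel_iso_def Domain_map_prod_image Range_map_prod_image card_image)

lemma rel_iso_finite: "rel_iso R S \<Longrightarrow> finite R \<Longrightarrow> finite S"
  by (auto simp: rel_iso_def)

text \<open>A type fits into \<open>N \<times> X\<close> as soon as the sizes allow it. With initial segments of
  the naturals in place of \<open>N\<close> and \<open>X\<close> this also provides representatives over a fixed
  type.\<close>

lemma rel_iso_into:
  assumes "finite R" "finite N" "finite X"
    and "card (Domain R) \<le> card N" "card (Range R) \<le> card X"
  obtains S where "S \<subseteq> N \<times> X" "rel_iso R S"
proof -
  have "finite (Domain R)" "finite (Range R)"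
    using \<open>finite R\<close> by (simp_all add: finite_Domain finite_Range)
  then obtain f g where f: "inj_on f (Domain R)" "f ` Domain R \<subseteq> N"
    and g: "inj_on g (Range R)" "g ` Range R \<subseteq> X"
    using assms by (metis card_le_inj)
  show ?thesis
  proof
    show "map_prod f g ` R \<subseteq> N \<times> X"
      using f g by (auto simp: image_subset_iff Domain.DomainI Range.RangeI)
    show "rel_iso R (map_prod f g ` R)"
      using f g unfolding rel_iso_def by blast
  qed
qed

text \<open>Only the members over the naturals are collected, so that types of relations over
  different base sets are objects of one HOL type. For a finite relation nothing is lost,
  because it has an isomorphic copy over the naturals.\<close>

definition iso_type :: "('a \<times> 'b) set \<Rightarrow> (nat \<times> nat) set set" where
  "iso_type R = {T. rel_iso R T}"

lemma iso_type_eq_iff: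
  assumes "finite R"
  shows "iso_type R = iso_type S \<longleftrightarrow> rel_iso R S"
proof
  obtain T :: "(nat \<times> nat) set" where "rel_iso R T"
    using rel_iso_into[OF assms, of "{..<card (Domain R)}" "{..<card (Range R)}"] by auto
  moreover from this have "rel_iso S T" if "iso_type R = iso_type S"
    using that by (auto simp: iso_type_def)
  ultimately show "rel_iso R S" if "iso_type R = iso_type S"
    using that rel_iso_trans rel_iso_sym by metis
  show "iso_type R = iso_type S" if "rel_iso R S"
    unfolding iso_type_def using rel_iso_trans[OF that] rel_iso_trans[OF rel_iso_sym[OF that]]
    by (intro Collect_cong iffI)
qed

definition iso_types :: "(nat \<times> nat) set \<Rightarrow> (nat \<times> nat) set set set" where
  "iso_types A = iso_type ` {T :: (nat \<times> nat) set.
      finite T \<and> (card (Domain T), card (Range T)) \<in> A}"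

text \<open>The right-hand side involves \<open>N\<close> and \<open>X\<close>, the left-hand side only the admissible
  sizes. This is what makes counts over different base sets comparable.\<close>

lemma iso_types_eq_image:
  assumes "finite N" "finite X" "A \<subseteq> {..card N} \<times> {..card X}"
  shows "iso_types A = iso_type ` {R \<in> Pow (N \<times> X). (card (Domain R), card (Range R)) \<in> A}"
    (is "_ = iso_type ` ?E")
proof
  show "iso_types A \<subseteq> iso_type ` ?E"
  proof
    fix t assume "t \<in> iso_types A"
    then obtain T :: "(nat \<times> nat) set"
      where T: "t = iso_type T" "finite T" "(card (Domain T), card (Range T)) \<in> A"
      by (auto simp: iso_types_def)
    with assms obtain R where "R \<subseteq> N \<times> X" "rel_iso T R"
      using rel_iso_into[of T N X] by auto
    with T show "t \<in> iso_type ` ?E"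
      by (auto simp: rel_iso_card iso_type_eq_iff)
  qed
  show "iso_type ` ?E \<subseteq> iso_types A"
  proof
    fix t assume "t \<in> iso_type ` ?E"
    then obtain R where R: "t = iso_type R" "R \<subseteq> N \<times> X" "(card (Domain R), card (Range R)) \<in> A"
      by auto
    then have "finite R"
      using assms finite_subset by blast
    then obtain T :: "(nat \<times> nat) set" where "rel_iso R T"
      using rel_iso_into[of R "{..<card (Domain R)}" "{..<card (Range R)}"] by auto
    with R \<open>finite R\<close> show "t \<in> iso_types A"
      by (auto simp: iso_types_def rel_iso_card iso_type_eq_iff rel_iso_finite)
  qed
qed

lemma finite_iso_types:
  assumes "finite A"
  shows "finite (iso_types A)"
proof -
  obtain n x where "fst ` A \<subseteq> {..n}" "snd ` A \<subseteq> {..x}"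
    using assms unfolding subset_iff atMost_iff
    by (metis finite_imageI finite_nat_set_iff_bounded_le)
  then have "A \<subseteq> {..n} \<times> {..x}"
    by force
  then show ?thesis
    using iso_types_eq_image[of "{..<n}" "{..<x}" A] by simp
qed

lemma card_iso_types_Un:
  assumes "finite A" "finite B" "A \<inter> B = {}"
  shows "card (iso_types (A \<union> B)) = card (iso_types A) + card (iso_types B)"
proof -
  have "iso_types (A \<union> B) = iso_types A \<union> iso_types B"
    by (auto simp: iso_types_def)
  moreover have "iso_types A \<inter> iso_types B = {}"
  proof (intro equals0I)
    fix t assume "t \<in> iso_types A \<inter> iso_types B"
    then obtain S T :: "(nat \<times> nat) set" where "finite S" "iso_type S = iso_type T"
      and "(card (Domain S), card (Range S)) \<in> A" "(card (Domain T), card (Range T)) \<in> B"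
      by (auto simp: iso_types_def)
    then show False
      using assms(3) by (auto simp: iso_type_eq_iff rel_iso_card)
  qed
  ultimately show ?thesis
    using assms by (simp add: card_Un_disjoint finite_iso_types)
qed

section \<open>Orbits of relations\<close>

text \<open>The complements of \<open>D\<close> and of its image have the same size, so they can be matched
  arbitrarily. This fails for infinite \<open>N\<close>.\<close>

lemma extend_to_permutation:
  assumes "finite N" "D \<subseteq> N" "inj_on f D" "f ` D \<subseteq> N"
  obtains \<pi> where "\<pi> \<in> Bij N" "\<And>i. i \<in> D \<Longrightarrow> \<pi> i = f i"
proof -
  have "card (N - D) = card (N - f ` D)"
    using assms by (simp add: card_Diff_subset finite_subset card_image)
  then obtain h where h: "bij_betw h (N - D) (N - f ` D)"
    using assms(1) finite_same_card_bij by blast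
  let ?\<pi> = "\<lambda>i\<in>N. if i \<in> D then f i else h i"
  have "bij_betw (\<lambda>i. if i \<in> D then f i else h i) (D \<union> (N - D)) (f ` D \<union> (N - f ` D))"
    using h assms(3) by (intro bij_betw_disjoint_Un) (auto simp: bij_betw_def)
  moreover have "D \<union> (N - D) = N" "f ` D \<union> (N - f ` D) = N"
    using assms by auto
  ultimately have "bij_betw (\<lambda>i. if i \<in> D then f i else h i) N N"
    by simp
  then have "?\<pi> \<in> Bij N"
    by (simp add: Bij_def)
  with assms(2) show ?thesis
    by (intro that[of ?\<pi>]) auto
qed

lemma carrier_sym_prod: "carrier (sym_prod N X) = Bij N \<times> Bij X"
  by (simp add: DirProd_def BijGroup_def)

lemma relation_action_eq: "relation_action (\<pi>, \<sigma>) R = map_prod \<pi> \<sigma> ` R"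
  by (force simp: relation_action_def)

lemma mem_relation_orbit_iff:
  "S \<in> orbit (sym_prod N X) relation_action R \<longleftrightarrow>
    (\<exists>\<pi>\<in>Bij N. \<exists>\<sigma>\<in>Bij X. S = map_prod \<pi> \<sigma> ` R)"
  unfolding orbit_def carrier_sym_prod relation_action_eq[symmetric] by blast

text \<open>The orbit is described by a condition in which the sets acted upon
  serve only as a bound. A permutation restricts to the domain and the range; conversely,
  partial injections extend to permutations.\<close>

lemma relation_orbit_eq:
  assumes "finite N" "finite X" "R \<subseteq> N \<times> X"
  shows "orbit (sym_prod N X) relation_action R = {S \<in> Pow (N \<times> X). rel_iso R S}"
proof -
  have DR: "Domain R \<subseteq> N" "Range R \<subseteq> X"
    using assms(3) by auto
  show ?thesis
  proof (intro equalityI subsetI)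
    fix S
    assume "S \<in> orbit (sym_prod N X) relation_action R"
    then obtain \<pi> \<sigma> where p: "\<pi> \<in> Bij N" "\<sigma> \<in> Bij X" and S: "S = map_prod \<pi> \<sigma> ` R"
      unfolding mem_relation_orbit_iff by blast
    have "bij_betw \<pi> N N" "bij_betw \<sigma> X X"
      using p by (auto simp: Bij_def)
    have "S \<subseteq> map_prod \<pi> \<sigma> ` (N \<times> X)"
      unfolding S using assms(3) by (rule image_mono)
    also have "\<dots> = N \<times> X"
      using \<open>bij_betw \<pi> N N\<close> \<open>bij_betw \<sigma> X X\<close>
      by (simp add: map_prod_surj_on bij_betw_imp_surj_on)
    finally have "S \<subseteq> N \<times> X" .
    moreover have "inj_on \<pi> (Domain R)" "inj_on \<sigma> (Range R)"
      using DR \<open>bij_betw \<pi> N N\<close> \<open>bij_betw \<sigma> X X\<close>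
      by (auto simp: bij_betw_def intro: inj_on_subset)
    ultimately show "S \<in> {S \<in> Pow (N \<times> X). rel_iso R S}"
      using S unfolding rel_iso_def by blast
  next
    fix S
    assume "S \<in> {S \<in> Pow (N \<times> X). rel_iso R S}"
    then obtain f g where f: "inj_on f (Domain R)" and g: "inj_on g (Range R)"
      and S: "S = map_prod f g ` R" and sub: "S \<subseteq> N \<times> X"
      by (auto simp: rel_iso_def)
    have "f ` Domain R \<subseteq> N" "g ` Range R \<subseteq> X"
      using sub S by auto
    then obtain \<pi> \<sigma> where "\<pi> \<in> Bij N" "\<sigma> \<in> Bij X"
      and ext: "\<And>i. i \<in> Domain R \<Longrightarrow> \<pi> i = f i" "\<And>a. a \<in> Range R \<Longrightarrow> \<sigma> a = g a"
      using extend_to_permutation[OF assms(1) DR(1) f] extend_to_permutation[OF assms(2) DR(2) g]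
      by metis
    moreover from ext have "map_prod \<pi> \<sigma> ` R = S"
      unfolding S by (intro image_cong refl) (auto simp: Domain.DomainI Range.RangeI)
    ultimately show "S \<in> orbit (sym_prod N X) relation_action R"
      unfolding mem_relation_orbit_iff by blast
  qed
qed

text \<open>Used to compare orbits with isomorphism types without constructing a bijection
  between them: both are invariants of a relation that separate the same pairs.\<close>

lemma card_image_same_kernel:
  assumes "\<And>x y. x \<in> E \<Longrightarrow> y \<in> E \<Longrightarrow> f x = f y \<longleftrightarrow> g x = g y"
  shows "card (f ` E) = card (g ` E)"
proof -
  have "f (inv_into E g (g x)) = f x" if "x \<in> E" for x
    using assms[of "inv_into E g (g x)" x] that by (simp add: f_inv_into_f inv_into_into)
  then have "bij_betw (\<lambda>t. f (inv_into E g t)) (g ` E) (f ` E)"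
    using assms by (auto simp: bij_betw_def inj_on_def image_image)
  then show ?thesis
    by (metis bij_betw_same_card)
qed

lemma orbits_eq_image: "orbits G E \<phi> = orbit G \<phi> ` E"
  by (auto simp: orbits_def)

lemma card_relation_orbits:
  fixes N :: "'a set" and X :: "'b set"
  assumes "finite N" "finite X" "A \<subseteq> {..card N} \<times> {..card X}"
  shows "card (relation_orbits N X {R \<in> Pow (N \<times> X). (card (Domain R), card (Range R)) \<in> A})
    = card (iso_types A)"
  unfolding iso_types_eq_image[OF assms] orbits_eq_image
proof (rule card_image_same_kernel)
  fix R S
  assume "R \<in> {R \<in> Pow (N \<times> X). (card (Domain R), card (Range R)) \<in> A}"
    and "S \<in> {R \<in> Pow (N \<times> X). (card (Domain R), card (Range R)) \<in> A}"
  then have sub: "R \<subseteq> N \<times> X" "S \<subseteq> N \<times> X"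
    by auto
  then have "finite R"
    using assms finite_subset by blast
  have "{T \<in> Pow (N \<times> X). rel_iso R T} = {T \<in> Pow (N \<times> X). rel_iso S T} \<longleftrightarrow> rel_iso R S"
  proof
    assume "{T \<in> Pow (N \<times> X). rel_iso R T} = {T \<in> Pow (N \<times> X). rel_iso S T}"
    moreover have "S \<in> {T \<in> Pow (N \<times> X). rel_iso S T}"
      using sub rel_iso_refl by auto
    ultimately show "rel_iso R S"
      by auto
  next
    assume "rel_iso R S"
    then have "rel_iso R T \<longleftrightarrow> rel_iso S T" for T :: "('a \<times> 'b) set"
      using rel_iso_trans rel_iso_sym by metis
    then show "{T \<in> Pow (N \<times> X). rel_iso R T} = {T \<in> Pow (N \<times> X). rel_iso S T}"
      by simp
  qed
  then show "orbit (sym_prod N X) relation_action R = orbit (sym_prod N X) relation_action S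
      \<longleftrightarrow> iso_type R = iso_type S"
    using sub \<open>finite R\<close> by (simp only: relation_orbit_eq[OF assms(1,2)] iso_type_eq_iff)
qed

lemma left_surjective_iff_card:
  assumes "finite N" "R \<subseteq> N \<times> X"
  shows "left_surjective N R \<longleftrightarrow> card (Domain R) = card N"
proof -
  have "Domain R \<subseteq> N"
    using assms(2) by auto
  then have "card (Domain R) = card N \<longleftrightarrow> Domain R = N"
    using assms(1) card_subset_eq by blast
  also have "\<dots> \<longleftrightarrow> left_surjective N R"
    using \<open>Domain R \<subseteq> N\<close> by (auto simp: left_surjective_def)
  finally show ?thesis ..
qed

lemma right_surjective_iff_card:
  assumes "finite X" "R \<subseteq> N \<times> X"
  shows "right_surjective X R \<longleftrightarrow> card (Range R) = card X"
proof -
  have "Range R \<subseteq> X"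
    using assms(2) by auto
  then have "card (Range R) = card X \<longleftrightarrow> Range R = X"
    using assms(1) card_subset_eq by blast
  also have "\<dots> \<longleftrightarrow> right_surjective X R"
    using \<open>Range R \<subseteq> X\<close> by (auto simp: right_surjective_def)
  finally show ?thesis ..
qed

lemma card_orbits_all_relations:
  assumes "finite N" "finite X"
  shows "card (relation_orbits N X (Pow (N \<times> X))) = card (iso_types ({..card N} \<times> {..card X}))"
proof -
  have "card (Domain R) \<le> card N" "card (Range R) \<le> card X" if "R \<subseteq> N \<times> X" for R
    using assms that by (auto intro!: card_mono)
  then have "Pow (N \<times> X) =
      {R \<in> Pow (N \<times> X). (card (Domain R), card (Range R)) \<in> {..card N} \<times> {..card X}}"
    by auto
  then show ?thesis
    using card_relation_orbits[OF assms order_refl] by simp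
qed

lemma card_orbits_right_surjective_relations:
  assumes "finite N" "finite X"
  shows "card (relation_orbits N X {R \<in> Pow (N \<times> X). right_surjective X R})
    = card (iso_types ({..card N} \<times> {card X}))"
proof -
  have "card (Domain R) \<le> card N" if "R \<subseteq> N \<times> X" for R
    using assms that by (auto intro!: card_mono)
  then have "{R \<in> Pow (N \<times> X). right_surjective X R} =
      {R \<in> Pow (N \<times> X). (card (Domain R), card (Range R)) \<in> {..card N} \<times> {card X}}"
    using right_surjective_iff_card[OF assms(2)] by auto
  then show ?thesis
    using card_relation_orbits[OF assms, of "{..card N} \<times> {card X}"] by auto
qed

lemma card_orbits_bisurjective_relations:
  assumes "finite N" "finite X"
  shows "card (relation_orbits N X (bisurjective_relations N X))
    = card (iso_types {(card N, card X)})"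
proof -
  have "bisurjective_relations N X =
      {R \<in> Pow (N \<times> X). (card (Domain R), card (Range R)) \<in> {(card N, card X)}}"
    using left_surjective_iff_card[OF assms(1)] right_surjective_iff_card[OF assms(2)]
    by (auto simp: bisurjective_relations_def)
  then show ?thesis
    using card_relation_orbits[OF assms, of "{(card N, card X)}"] by simp
qed

section \<open>Families and homomorphisms\<close>

text \<open>Transfers an orbit count along an equivariant encoding. Injectivity and closure are
  asked of the larger set \<open>E\<close>, so that subsets \<open>D\<close> such as the coverings need no separate proof
  that the action preserves them.\<close>

lemma card_orbits_image:
  assumes "inj_on h E"
    and "\<And>g x. g \<in> carrier G \<Longrightarrow> x \<in> E \<Longrightarrow> \<phi> g x \<in> E"
    and "\<And>g x. g \<in> carrier G \<Longrightarrow> x \<in> E \<Longrightarrow> h (\<phi> g x) = \<psi> g (h x)"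
    and "D \<subseteq> E"
  shows "card (orbits G (h ` D) \<psi>) = card (orbits G D \<phi>)"
proof -
  have "orbit G \<psi> (h x) = h ` orbit G \<phi> x" if "x \<in> D" for x
    using assms(3,4) that by (force simp: orbit_def)
  then have "orbits G (h ` D) \<psi> = (`) h ` orbits G D \<phi>"
    by (simp add: orbits_eq_image image_image)
  moreover have "\<Union> (orbits G D \<phi>) \<subseteq> E"
    using assms(2,4) by (auto simp: orbits_def orbit_def)
  then have "inj_on ((`) h) (orbits G D \<phi>)"
    using assms(1) inj_on_image inj_on_subset by blast
  ultimately show ?thesis
    by (simp add: card_image)
qed

lemma Bij_mem: "\<sigma> \<in> Bij X \<Longrightarrow> a \<in> X \<Longrightarrow> \<sigma> a \<in> X"
  by (auto simp: Bij_def bij_betw_def)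

lemma family_action_closed:
  assumes "g \<in> carrier (sym_prod N X)" "F \<in> families N X"
  shows "family_action N g F \<in> families N X"
proof -
  obtain \<pi> \<sigma> where "g = (\<pi>, \<sigma>)" "\<pi> \<in> Bij N" "\<sigma> \<in> Bij X"
    using assms(1) unfolding carrier_sym_prod by blast
  then show ?thesis
    using assms(2) Bij_inv_into_mem[of \<pi> N] Bij_mem[of \<sigma> X]
    by (fastforce simp: families_def family_action_def PiE_iff)
qed

lemma Sigma_family_action:
  assumes "g \<in> carrier (sym_prod N X)"
  shows "Sigma N (family_action N g F) = relation_action g (Sigma N F)"
proof -
  obtain \<pi> \<sigma> where g: "g = (\<pi>, \<sigma>)" "\<pi> \<in> Bij N" "\<sigma> \<in> Bij X"
    using assms(1) unfolding carrier_sym_prod by blast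
  have bij: "inj_on \<pi> N" "\<pi> ` N = N"
    using g by (auto simp: Bij_def bij_betw_def)
  then have "Sigma N (family_action N g F) = Sigma (\<pi> ` N) (\<lambda>i. \<sigma> ` F (inv_into N \<pi> i))"
    by (auto simp: g family_action_def)
  also have "\<dots> = map_prod \<pi> \<sigma> ` Sigma N F"
    using bij(1) by (force simp: image_iff inv_into_f_f)
  finally show ?thesis
    by (simp add: g relation_action_eq)
qed

lemma inj_on_Sigma_families: "inj_on (Sigma N) (families N X)"
proof (rule inj_onI)
  fix F G assume FG: "F \<in> families N X" "G \<in> families N X" "Sigma N F = Sigma N G"
  then have "F i = G i" if "i \<in> N" for i
    using that by (auto simp: set_eq_iff)
  with FG(1,2) show "F = G"
    unfolding families_def by (metis PiE_ext)
qed

lemma Sigma_image_families: "Sigma N ` families N X = Pow (N \<times> X)"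
proof
  show "Pow (N \<times> X) \<subseteq> Sigma N ` families N X"
  proof
    fix R assume R: "R \<in> Pow (N \<times> X)"
    then have "R = Sigma N (\<lambda>i\<in>N. R `` {i})" "(\<lambda>i\<in>N. R `` {i}) \<in> families N X"
      by (auto simp: families_def)
    then show "R \<in> Sigma N ` families N X"
      by (rule image_eqI)
  qed
qed (fastforce simp: families_def)

lemma Sigma_mem_iff:
  assumes "F \<in> families N X"
  shows "F \<in> coverings N X \<longleftrightarrow> right_surjective X (Sigma N F)"
    and "F \<in> hypergraphs N X \<longleftrightarrow>
      left_surjective N (Sigma N F) \<and> right_surjective X (Sigma N F)"
proof -
  have "(\<Union>i\<in>N. F i) \<subseteq> X"
    using assms by (auto simp: families_def PiE_iff)
  then show *: "F \<in> coverings N X \<longleftrightarrow> right_surjective X (Sigma N F)"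
    using assms by (auto simp: coverings_def right_surjective_def)
  show "F \<in> hypergraphs N X \<longleftrightarrow>
      left_surjective N (Sigma N F) \<and> right_surjective X (Sigma N F)"
    using * by (auto simp: hypergraphs_def left_surjective_def)
qed

lemma Sigma_image_coverings:
  "Sigma N ` coverings N X = {R \<in> Pow (N \<times> X). right_surjective X R}"
proof -
  have "coverings N X = {F \<in> families N X. right_surjective X (Sigma N F)}"
    using Sigma_mem_iff(1) by (auto simp: coverings_def)
  then show ?thesis
    unfolding Sigma_image_families[symmetric] by blast
qed

lemma Sigma_image_hypergraphs:
  "Sigma N ` hypergraphs N X = bisurjective_relations N X"
proof -
  have "hypergraphs N X = {F \<in> families N X.
      left_surjective N (Sigma N F) \<and> right_surjective X (Sigma N F)}"
    using Sigma_mem_iff(2) by (auto simp: hypergraphs_def coverings_def)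
  then show ?thesis
    unfolding bisurjective_relations_def Sigma_image_families[symmetric] by blast
qed

lemma card_family_orbits_eq:
  assumes "D \<subseteq> families N X"
  shows "card (family_orbits N X D) = card (relation_orbits N X (Sigma N ` D))"
  by (intro card_orbits_image[where E = "families N X", symmetric] assms
      inj_on_Sigma_families family_action_closed Sigma_family_action)

definition atoms :: "'a set \<Rightarrow> ('a set \<Rightarrow> 'b set) \<Rightarrow> ('a \<Rightarrow> 'b set)" where
  "atoms N \<phi> = (\<lambda>i\<in>N. \<phi> {i})"

text \<open>Finiteness of \<open>N\<close> is essential: a homomorphism preserves only finite unions.\<close>

lemma homomorphism_eq_Union:
  assumes "\<phi> \<in> homomorphisms N X" "finite N" "I \<subseteq> N"
  shows "\<phi> I = (\<Union>i\<in>I. atoms N \<phi> i)"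
proof -
  have "finite I"
    using assms finite_subset by blast
  then show ?thesis
    using assms(3)
  proof induction
    case empty
    then show ?case using assms(1) by (simp add: homomorphisms_def)
  next
    case (insert i I)
    have "\<phi> ({i} \<union> I) = \<phi> {i} \<union> \<phi> I"
      using assms(1) insert.prems unfolding homomorphisms_def by blast
    with insert show ?case by (simp add: atoms_def)
  qed
qed

lemma inj_on_atoms:
  assumes "finite N"
  shows "inj_on (atoms N) (homomorphisms N X)"
proof (rule inj_onI)
  fix \<phi> \<psi> assume *: "\<phi> \<in> homomorphisms N X" "\<psi> \<in> homomorphisms N X" "atoms N \<phi> = atoms N \<psi>"
  then have "\<phi> I = \<psi> I" if "I \<in> Pow N" for I
    using homomorphism_eq_Union assms that by (metis PowD)
  moreover have "\<phi> \<in> Pow N \<rightarrow>\<^sub>E Pow X" "\<psi> \<in> Pow N \<rightarrow>\<^sub>E Pow X"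
    using * by (auto simp: homomorphisms_def)
  ultimately show "\<phi> = \<psi>"
    by (metis PiE_ext)
qed

lemma atoms_image_homomorphisms: "atoms N ` homomorphisms N X = families N X"
proof
  show "atoms N ` homomorphisms N X \<subseteq> families N X"
    by (fastforce simp: atoms_def homomorphisms_def families_def PiE_iff)
  show "families N X \<subseteq> atoms N ` homomorphisms N X"
  proof
    fix F assume F: "F \<in> families N X"
    let ?\<phi> = "\<lambda>I\<in>Pow N. \<Union>i\<in>I. F i"
    have "?\<phi> \<in> homomorphisms N X"
      using F by (fastforce simp: homomorphisms_def families_def PiE_iff)
    moreover have "F = atoms N ?\<phi>"
      using F by (auto simp: atoms_def families_def PiE_iff extensional_def fun_eq_iff)
    ultimately show "F \<in> atoms N ` homomorphisms N X"
      by blast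
  qed
qed

lemma atoms_image_meet_unitary:
  assumes "finite N"
  shows "atoms N ` meet_unitary_homomorphisms N X = coverings N X"
proof -
  have "meet_unitary_homomorphisms N X
      = {\<phi> \<in> homomorphisms N X. (\<Union>i\<in>N. atoms N \<phi> i) = X}"
    unfolding meet_unitary_homomorphisms_def
    using homomorphism_eq_Union[OF _ assms order_refl] by blast
  then show ?thesis
    unfolding coverings_def atoms_image_homomorphisms[symmetric] by blast
qed

lemma homomorphism_action_closed:
  assumes "g \<in> carrier (sym_prod N X)" "\<phi> \<in> homomorphisms N X"
  shows "homomorphism_action N g \<phi> \<in> homomorphisms N X"
proof -
  obtain \<pi> \<sigma> where g: "g = (\<pi>, \<sigma>)" "\<pi> \<in> Bij N" "\<sigma> \<in> Bij X"
    using assms(1) unfolding carrier_sym_prod by blast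
  have sub: "inv_into N \<pi> ` I \<subseteq> N" if "I \<subseteq> N" for I
    using that Bij_inv_into_mem[OF g(2)] by auto
  have "\<sigma> ` \<phi> I \<subseteq> X" if "I \<subseteq> N" for I
  proof -
    have "\<phi> I \<subseteq> X"
      using assms(2) that by (auto simp: homomorphisms_def PiE_iff)
    then show ?thesis
      using Bij_mem[OF g(3)] by auto
  qed
  moreover have "\<phi> (I \<union> J) = \<phi> I \<union> \<phi> J" if "I \<subseteq> N" "J \<subseteq> N" for I J
    using assms(2) that by (simp add: homomorphisms_def)
  moreover have "\<phi> {} = {}"
    using assms(2) by (simp add: homomorphisms_def)
  ultimately show ?thesis
    unfolding homomorphisms_def homomorphism_action_def g prod.case
    using sub by (simp add: image_Un)
qed

lemma atoms_homomorphism_action: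
  assumes "g \<in> carrier (sym_prod N X)"
  shows "atoms N (homomorphism_action N g \<phi>) = family_action N g (atoms N \<phi>)"
proof -
  obtain \<pi> \<sigma> where g: "g = (\<pi>, \<sigma>)" "\<pi> \<in> Bij N"
    using assms(1) unfolding carrier_sym_prod by blast
  then show ?thesis
    using Bij_inv_into_mem[OF g(2)]
    by (auto simp: atoms_def homomorphism_action_def family_action_def fun_eq_iff)
qed

lemma card_homomorphism_orbits_eq:
  assumes "finite N" "D \<subseteq> homomorphisms N X"
  shows "card (homomorphism_orbits N X D) = card (family_orbits N X (atoms N ` D))"
  by (intro card_orbits_image[where E = "homomorphisms N X", symmetric] assms
      inj_on_atoms homomorphism_action_closed atoms_homomorphism_action)

section \<open>The counting functions\<close>

lemma card_orbits:
  assumes "finite N" "finite X"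
  shows "card (family_orbits N X (families N X)) = card (iso_types ({..card N} \<times> {..card X}))"
    and "card (homomorphism_orbits N X (homomorphisms N X))
      = card (iso_types ({..card N} \<times> {..card X}))"
    and "card (family_orbits N X (coverings N X)) = card (iso_types ({..card N} \<times> {card X}))"
    and "card (homomorphism_orbits N X (meet_unitary_homomorphisms N X))
      = card (iso_types ({..card N} \<times> {card X}))"
    and "card (family_orbits N X (hypergraphs N X)) = card (iso_types {(card N, card X)})"
proof -
  have sub: "coverings N X \<subseteq> families N X" "hypergraphs N X \<subseteq> families N X"
    "meet_unitary_homomorphisms N X \<subseteq> homomorphisms N X"
    by (auto simp: coverings_def hypergraphs_def meet_unitary_homomorphisms_def)
  show fam: "card (family_orbits N X (families N X))
      = card (iso_types ({..card N} \<times> {..card X}))"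
    unfolding card_family_orbits_eq[OF order_refl] Sigma_image_families
    by (rule card_orbits_all_relations[OF assms])
  show cov: "card (family_orbits N X (coverings N X))
      = card (iso_types ({..card N} \<times> {card X}))"
    unfolding card_family_orbits_eq[OF sub(1)] Sigma_image_coverings
    by (rule card_orbits_right_surjective_relations[OF assms])
  show "card (family_orbits N X (hypergraphs N X)) = card (iso_types {(card N, card X)})"
    unfolding card_family_orbits_eq[OF sub(2)] Sigma_image_hypergraphs
    by (rule card_orbits_bisurjective_relations[OF assms])
  show "card (homomorphism_orbits N X (homomorphisms N X))
      = card (iso_types ({..card N} \<times> {..card X}))"
    unfolding card_homomorphism_orbits_eq[OF assms(1) order_refl] atoms_image_homomorphisms
    by (rule fam)
  show "card (homomorphism_orbits N X (meet_unitary_homomorphisms N X))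
      = card (iso_types ({..card N} \<times> {card X}))"
    unfolding card_homomorphism_orbits_eq[OF assms(1) sub(3)] atoms_image_meet_unitary[OF assms(1)]
    by (rule cov)
qed

lemma alpha_of_nat: "alpha (int n) (int x) = int (card (iso_types ({..n} \<times> {..x})))"
  by (simp add: alpha_def Let_def card_orbits)

lemma beta_of_nat: "beta (int n) (int x) = int (card (iso_types ({..n} \<times> {x})))"
  by (simp add: beta_def Let_def card_orbits)

lemma gamma_of_nat: "gamma (int n) (int x) = int (card (iso_types {(n, x)}))"
  by (simp add: gamma_def Let_def card_orbits)

lemma beta_eq_alpha_diff:
  "beta (int n) (int x) = alpha (int n) (int x) - alpha (int n) (int x - 1)"
proof (cases x)
  case 0
  then show ?thesis
    unfolding alpha_of_nat beta_of_nat by (simp add: alpha_def)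
next
  case (Suc y)
  have "{..n} \<times> {..Suc y} = {..n} \<times> {Suc y} \<union> {..n} \<times> {..y}"
    by auto
  then have "card (iso_types ({..n} \<times> {..Suc y}))
      = card (iso_types ({..n} \<times> {Suc y})) + card (iso_types ({..n} \<times> {..y}))"
    by (simp only:) (rule card_iso_types_Un; auto)
  moreover have "int x - 1 = int y"
    using Suc by simp
  ultimately show ?thesis
    unfolding \<open>int x - 1 = int y\<close> alpha_of_nat beta_of_nat by (simp add: Suc)
qed

lemma gamma_eq_beta_diff:
  "gamma (int n) (int x) = beta (int n) (int x) - beta (int n - 1) (int x)"
proof (cases n)
  case 0
  then show ?thesis
    unfolding beta_of_nat gamma_of_nat by (simp add: beta_def)
next
  case (Suc m)
  have "{..Suc m} \<times> {x} = {(Suc m, x)} \<union> {..m} \<times> {x}"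
    by auto
  then have "card (iso_types ({..Suc m} \<times> {x}))
      = card (iso_types {(Suc m, x)}) + card (iso_types ({..m} \<times> {x}))"
    by (simp only:) (rule card_iso_types_Un; auto)
  moreover have "int n - 1 = int m"
    using Suc by simp
  ultimately show ?thesis
    unfolding \<open>int n - 1 = int m\<close> beta_of_nat gamma_of_nat by (simp add: Suc)
qed

theorem mainTheorem4:
  fixes n x :: int
  assumes "n \<ge> 0" and "x \<ge> 0"
  shows "(\<forall>(N :: 'a set) (X :: 'b set).
            finite N \<and> finite X \<and> int (card N) = n \<and> int (card X) = x \<longrightarrow>
              alpha n x = int (card (homomorphism_orbits N X (homomorphisms N X))) \<and>
              alpha n x = int (card (family_orbits N X (families N X))) \<and>
              beta n x = int (card (homomorphism_orbits N X (meet_unitary_homomorphisms N X))) \<and>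
              beta n x = int (card (family_orbits N X (coverings N X))) \<and>
              gamma n x = int (card (family_orbits N X (hypergraphs N X))) \<and>
              gamma n x = int (card (relation_orbits N X (bisurjective_relations N X)))) \<and>
         beta n x = alpha n x - alpha n (x - 1) \<and>
         gamma n x = beta n x - beta (n - 1) x"
proof -
  obtain n' x' where nx: "n = int n'" "x = int x'"
    using assms nonneg_int_cases by metis
  show ?thesis
    unfolding nx
    using beta_eq_alpha_diff gamma_eq_beta_diff
    by (auto simp: alpha_of_nat beta_of_nat gamma_of_nat card_orbits
        card_orbits_bisurjective_relations)
qed

end
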